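(* For all formulas $\alpha,\beta$ built from variables by $\cdot,\backslash,\wedge,\vee,\neg$: if $\vdash_{\mathsf{G}}\alpha\Rightarrow\beta$, then $\vdash_{\mathsf{G_c}}\alpha\Rightarrow\beta$.
   Context: The calculus $\mathsf{G}$: formulas are built from variables by $\alpha\cdot\beta$, $\alpha\backslash\beta$, $\alpha\wedge\beta$, $\alpha\vee\beta$, $\neg\alpha$; sequents $\alpha\Rightarrow\beta$; axioms $(\mathrm{Id})\ \alpha\Rightarrow\alpha$, $(\mathrm{DN2})\ \neg\neg\alpha\Rightarrow\alpha$; rules (premises / conclusion): $(\mathrm{RES}\backslash)$ $\alpha\cdot\beta\Rightarrow\gamma$ / $\beta\Rightarrow\alpha\backslash\gamma$; $(\mathrm{RES}^-\backslash)$ $\beta\Rightarrow\alpha\backslash\gamma$ / $\alpha\cdot\beta\Rightarrow\gamma$; $(\wedge\mathrm{L})$ $\alpha\Rightarrow\beta$ / $\alpha\wedge\gamma\Rightarrow\beta$ and $\alpha\Rightarrow\beta$ / $\gamma\wedge\alpha\Rightarrow\beta$; $(\wedge\mathrm{R})$ $\alpha\Rightarrow\beta$, $\alpha\Rightarrow\gamma$ / $\alpha\Rightarrow\beta\wedge\gamma$; $(\vee\mathrm{L})$ $\alpha\Rightarrow\beta$, $\gamma\Rightarrow\beta$ / $\alpha\vee\gamma\Rightarrow\beta$; $(\vee\mathrm{R})$ $\alpha\Rightarrow\beta$ / $\alpha\Rightarrow\beta\vee\gamma$ and $\alpha\Rightarrow\beta$ / $\alpha\Rightarrow\gamma\vee\beta$;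 $(\neg)$ $\alpha\cdot\beta\Rightarrow\neg\gamma$ / $\gamma\cdot\beta\Rightarrow\neg\alpha$ and its special case $(\mathrm{MN})$ $\alpha\Rightarrow\neg\gamma$ / $\gamma\Rightarrow\neg\alpha$; $(\mathrm{Cut})$ $\alpha\Rightarrow\beta$, $\beta\Rightarrow\gamma$ / $\alpha\Rightarrow\gamma$. The Kolmogorov translation $ko$: $ko(p)=\neg\neg p$ for variables; $ko(\alpha\wedge\beta)=\neg\neg(ko(\alpha)\wedge ko(\beta))$; $ko(\alpha\vee\beta)=\neg\neg(ko(\alpha)\vee ko(\beta))$; $ko(\neg\alpha)=\neg ko(\alpha)$; $ko(\alpha\cdot\beta)=\neg\neg(ko(\alpha)\cdot ko(\beta))$; $ko(\alpha\backslash\beta)=\neg\neg(ko(\alpha)\backslash ko(\beta))$. The calculus $\mathsf{G_c}$: formulas are variables, the constant $\bot$, and $\alpha\cdot\beta$, $\alpha\backslash\beta$, $\alpha\wedge\beta$, $\alpha\vee\beta$, $\neg\alpha$ (with $\neg$ primitive). Formula structures: every formula is a structure, and if $\Gamma,\Delta$ are structures so are $(\Gamma,\Delta)$ and $(\Gamma;\Delta)$; a context $\Gamma[-]$ is a structure with one hole, $\Gamma[\Delta]$ the result of filling it; sequents are $\Gamma\Rightarrow\alpha$. $\mathsf{G_c}$ has NO cut rule; its rules are: $(\mathrm{Id})$ $\alpha\Rightarrow\alpha$; $(\cdot\mathrm{L})$ $\Gamma[\alpha,\beta]\Rightarrow\gamma$ / $\Gamma[\alpha\cdot\beta]\Rightarrow\gamma$;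 $(\cdot\mathrm{R})$ $\Gamma_1\Rightarrow\alpha$, $\Gamma_2\Rightarrow\beta$ / $\Gamma_1,\Gamma_2\Rightarrow\alpha\cdot\beta$; $(\backslash\mathrm{L})$ $\Delta\Rightarrow\alpha$, $\Gamma[\beta]\Rightarrow\gamma$ / $\Gamma[\Delta,\alpha\backslash\beta]\Rightarrow\gamma$; $(\backslash\mathrm{R})$ $\alpha,\Gamma\Rightarrow\beta$ / $\Gamma\Rightarrow\alpha\backslash\beta$; $(\neg\mathrm{L})$ $\Delta\Rightarrow\alpha$ / $\Delta;\neg\alpha\Rightarrow\bot$; $(\neg\mathrm{R})$ $\alpha;\Gamma\Rightarrow\bot$ / $\Gamma\Rightarrow\neg\alpha$; $(\wedge\mathrm{L})$ $\Gamma[\alpha]\Rightarrow\beta$ / $\Gamma[\alpha\wedge\gamma]\Rightarrow\beta$ and $\Gamma[\alpha]\Rightarrow\beta$ / $\Gamma[\gamma\wedge\alpha]\Rightarrow\beta$; $(\wedge\mathrm{R})$ $\Gamma\Rightarrow\alpha$, $\Gamma\Rightarrow\beta$ / $\Gamma\Rightarrow\alpha\wedge\beta$; $(\vee\mathrm{L})$ $\Gamma[\alpha]\Rightarrow\gamma$, $\Gamma[\beta]\Rightarrow\gamma$ / $\Gamma[\alpha\vee\beta]\Rightarrow\gamma$; $(\vee\mathrm{R})$ $\Gamma\Rightarrow\alpha$ / $\Gamma\Rightarrow\alpha\vee\beta$ and $\Gamma\Rightarrow\alpha$ / $\Gamma\Rightarrow\beta\vee\alpha$; $(\bot)$ $\Delta\Rightarrow\bot$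 / $\Gamma[\Delta]\Rightarrow\alpha$; $(\mathrm{R}\text{-}\bot)$ $(\Delta_1,\Delta_2);\Delta_3\Rightarrow\bot$ / $(\Delta_1,\Delta_3);\Delta_2\Rightarrow\bot$; $(\mathrm{Ex})$ $\Gamma[\Delta_1,\Delta_2]\Rightarrow\beta$ / $\Gamma[\Delta_2,\Delta_1]\Rightarrow\beta$; $(\mathrm{Ex}^;)$ $\Gamma[\Delta_1;\Delta_2]\Rightarrow\beta$ / $\Gamma[\Delta_2;\Delta_1]\Rightarrow\beta$; $(\mathrm{As}_1)$ $\Gamma[\Delta_1,(\Delta_2,\Delta_3)]\Rightarrow\beta$ / $\Gamma[(\Delta_1,\Delta_2),\Delta_3]\Rightarrow\beta$; $(\mathrm{As}_2)$ the converse of $(\mathrm{As}_1)$; $(\mathrm{koL})$ $\Gamma[ko(\alpha)]\Rightarrow\beta$ / $\Gamma[\alpha]\Rightarrow\beta$; $(\mathrm{koR})$ $\Gamma\Rightarrow ko(\alpha)$ / $\Gamma\Rightarrow\alpha$. *)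

theory Defs
  imports Main
begin

datatype 'v fm =
    Var 'v
  | Mult "'v fm" "'v fm"  (infixr "\<cdot>" 70)
  | LDiv "'v fm" "'v fm"  (infixr "\<setminus>" 70)
  | And "'v fm" "'v fm"   (infixr "\<^bold>\<and>" 67)
  | Or "'v fm" "'v fm"    (infixr "\<^bold>\<or>" 66)
  | Neg "'v fm"           ("\<sim> _" [75] 75)

inductive G :: "'v fm \<Rightarrow> 'v fm \<Rightarrow> bool"  ("\<turnstile>\<^sub>G _ \<Rightarrow> _" [60, 60] 50) where
  Id:     "\<turnstile>\<^sub>G \<alpha> \<Rightarrow> \<alpha>"
| DN2:    "\<turnstile>\<^sub>G \<sim> \<sim> \<alpha> \<Rightarrow> \<alpha>"
| Res:    "\<turnstile>\<^sub>G \<alpha> \<cdot> \<beta> \<Rightarrow> \<gamma> \<Longrightarrow> \<turnstile>\<^sub>G \<beta> \<Rightarrow> \<alpha> \<setminus> \<gamma>"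
| ResInv: "\<turnstile>\<^sub>G \<beta> \<Rightarrow> \<alpha> \<setminus> \<gamma> \<Longrightarrow> \<turnstile>\<^sub>G \<alpha> \<cdot> \<beta> \<Rightarrow> \<gamma>"
| AndL1:  "\<turnstile>\<^sub>G \<alpha> \<Rightarrow> \<beta> \<Longrightarrow> \<turnstile>\<^sub>G \<alpha> \<^bold>\<and> \<gamma> \<Rightarrow> \<beta>"
| AndL2:  "\<turnstile>\<^sub>G \<alpha> \<Rightarrow> \<beta> \<Longrightarrow> \<turnstile>\<^sub>G \<gamma> \<^bold>\<and> \<alpha> \<Rightarrow> \<beta>"
| AndR:   "\<turnstile>\<^sub>G \<alpha> \<Rightarrow> \<beta> \<Longrightarrow> \<turnstile>\<^sub>G \<alpha> \<Rightarrow> \<gamma> \<Longrightarrow> \<turnstile>\<^sub>G \<alpha> \<Rightarrow> \<beta> \<^bold>\<and> \<gamma>"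
| OrL:    "\<turnstile>\<^sub>G \<alpha> \<Rightarrow> \<beta> \<Longrightarrow> \<turnstile>\<^sub>G \<gamma> \<Rightarrow> \<beta> \<Longrightarrow> \<turnstile>\<^sub>G \<alpha> \<^bold>\<or> \<gamma> \<Rightarrow> \<beta>"
| OrR1:   "\<turnstile>\<^sub>G \<alpha> \<Rightarrow> \<beta> \<Longrightarrow> \<turnstile>\<^sub>G \<alpha> \<Rightarrow> \<beta> \<^bold>\<or> \<gamma>"
| OrR2:   "\<turnstile>\<^sub>G \<alpha> \<Rightarrow> \<beta> \<Longrightarrow> \<turnstile>\<^sub>G \<alpha> \<Rightarrow> \<gamma> \<^bold>\<or> \<beta>"
| Neg:    "\<turnstile>\<^sub>G \<alpha> \<cdot> \<beta> \<Rightarrow> \<sim> \<gamma> \<Longrightarrow> \<turnstile>\<^sub>G \<gamma> \<cdot> \<beta> \<Rightarrow> \<sim> \<alpha>"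
| MN:     "\<turnstile>\<^sub>G \<alpha> \<Rightarrow> \<sim> \<gamma> \<Longrightarrow> \<turnstile>\<^sub>G \<gamma> \<Rightarrow> \<sim> \<alpha>"
| Cut:    "\<turnstile>\<^sub>G \<alpha> \<Rightarrow> \<beta> \<Longrightarrow> \<turnstile>\<^sub>G \<beta> \<Rightarrow> \<gamma> \<Longrightarrow> \<turnstile>\<^sub>G \<alpha> \<Rightarrow> \<gamma>"

fun ko :: "'v fm \<Rightarrow> 'v fm" where
  "ko (Var p) = \<sim> \<sim> Var p"
| "ko (\<alpha> \<^bold>\<and> \<beta>) = \<sim> \<sim> (ko \<alpha> \<^bold>\<and> ko \<beta>)"
| "ko (\<alpha> \<^bold>\<or> \<beta>) = \<sim> \<sim> (ko \<alpha> \<^bold>\<or> ko \<beta>)"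
| "ko (\<sim> \<alpha>) = \<sim> (ko \<alpha>)"
| "ko (\<alpha> \<cdot> \<beta>) = \<sim> \<sim> (ko \<alpha> \<cdot> ko \<beta>)"
| "ko (\<alpha> \<setminus> \<beta>) = \<sim> \<sim> (ko \<alpha> \<setminus> ko \<beta>)"

datatype 'v cfm =
    CVar 'v
  | CBot                     ("\<bottom>\<^sub>c")
  | CMult "'v cfm" "'v cfm"  (infixr "\<cdot>\<^sub>c" 70)
  | CLDiv "'v cfm" "'v cfm"  (infixr "\<setminus>\<^sub>c" 70)
  | CAnd "'v cfm" "'v cfm"   (infixr "\<and>\<^sub>c" 67)
  | COr "'v cfm" "'v cfm"    (infixr "\<or>\<^sub>c" 66)
  | CNeg "'v cfm"            ("\<sim>\<^sub>c _" [75] 75)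

fun emb :: "'v fm \<Rightarrow> 'v cfm" where
  "emb (Var p) = CVar p"
| "emb (\<alpha> \<cdot> \<beta>) = emb \<alpha> \<cdot>\<^sub>c emb \<beta>"
| "emb (\<alpha> \<setminus> \<beta>) = emb \<alpha> \<setminus>\<^sub>c emb \<beta>"
| "emb (\<alpha> \<^bold>\<and> \<beta>) = emb \<alpha> \<and>\<^sub>c emb \<beta>"
| "emb (\<alpha> \<^bold>\<or> \<beta>) = emb \<alpha> \<or>\<^sub>c emb \<beta>"
| "emb (\<sim> \<alpha>) = \<sim>\<^sub>c emb \<alpha>"

datatype 'v struct =
    Fm "'v cfm"
  | Comma "'v struct" "'v struct"
  | Semi "'v struct" "'v struct"

datatype 'v ctx =
    Hole
  | CommaL "'v ctx" "'v struct"
  | CommaR "'v struct" "'v ctx"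
  | SemiL "'v ctx" "'v struct"
  | SemiR "'v struct" "'v ctx"

fun fill :: "'v ctx \<Rightarrow> 'v struct \<Rightarrow> 'v struct"  ("_\<lbrakk>_\<rbrakk>" [90, 0] 90) where
  "Hole\<lbrakk>\<Delta>\<rbrakk> = \<Delta>"
| "(CommaL \<Gamma> \<Sigma>)\<lbrakk>\<Delta>\<rbrakk> = Comma (\<Gamma>\<lbrakk>\<Delta>\<rbrakk>) \<Sigma>"
| "(CommaR \<Sigma> \<Gamma>)\<lbrakk>\<Delta>\<rbrakk> = Comma \<Sigma> (\<Gamma>\<lbrakk>\<Delta>\<rbrakk>)"
| "(SemiL \<Gamma> \<Sigma>)\<lbrakk>\<Delta>\<rbrakk> = Semi (\<Gamma>\<lbrakk>\<Delta>\<rbrakk>) \<Sigma>"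
| "(SemiR \<Sigma> \<Gamma>)\<lbrakk>\<Delta>\<rbrakk> = Semi \<Sigma> (\<Gamma>\<lbrakk>\<Delta>\<rbrakk>)"

text \<open>The translation \<^const>\<open>ko\<close> has no clause for the constant \<^const>\<open>CBot\<close>, so the rules
  \<open>koL\<close> and \<open>koR\<close> below apply exactly to the formulas without that constant, i.e. to those in the
  range of \<^const>\<open>emb\<close>.\<close>

inductive Gc :: "'v struct \<Rightarrow> 'v cfm \<Rightarrow> bool"  ("\<turnstile>\<^sub>G\<^sub>c _ \<Rightarrow> _" [60, 60] 50) where
  Id:    "\<turnstile>\<^sub>G\<^sub>c Fm \<alpha> \<Rightarrow> \<alpha>"
| MultL: "\<turnstile>\<^sub>G\<^sub>c \<Gamma>\<lbrakk>Comma (Fm \<alpha>) (Fm \<beta>)\<rbrakk> \<Rightarrow> \<gamma> \<Longrightarrow> \<turnstile>\<^sub>G\<^sub>c \<Gamma>\<lbrakk>Fm (\<alpha> \<cdot>\<^sub>c \<beta>)\<rbrakk> \<Rightarrow> \<gamma>"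
| MultR: "\<turnstile>\<^sub>G\<^sub>c \<Gamma>\<^sub>1 \<Rightarrow> \<alpha> \<Longrightarrow> \<turnstile>\<^sub>G\<^sub>c \<Gamma>\<^sub>2 \<Rightarrow> \<beta> \<Longrightarrow> \<turnstile>\<^sub>G\<^sub>c Comma \<Gamma>\<^sub>1 \<Gamma>\<^sub>2 \<Rightarrow> \<alpha> \<cdot>\<^sub>c \<beta>"
| LDivL: "\<turnstile>\<^sub>G\<^sub>c \<Delta> \<Rightarrow> \<alpha> \<Longrightarrow> \<turnstile>\<^sub>G\<^sub>c \<Gamma>\<lbrakk>Fm \<beta>\<rbrakk> \<Rightarrow> \<gamma> \<Longrightarrow> \<turnstile>\<^sub>G\<^sub>c \<Gamma>\<lbrakk>Comma \<Delta> (Fm (\<alpha> \<setminus>\<^sub>c \<beta>))\<rbrakk> \<Rightarrow> \<gamma>"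
| LDivR: "\<turnstile>\<^sub>G\<^sub>c Comma (Fm \<alpha>) \<Gamma> \<Rightarrow> \<beta> \<Longrightarrow> \<turnstile>\<^sub>G\<^sub>c \<Gamma> \<Rightarrow> \<alpha> \<setminus>\<^sub>c \<beta>"
| NegL:  "\<turnstile>\<^sub>G\<^sub>c \<Delta> \<Rightarrow> \<alpha> \<Longrightarrow> \<turnstile>\<^sub>G\<^sub>c Semi \<Delta> (Fm (\<sim>\<^sub>c \<alpha>)) \<Rightarrow> \<bottom>\<^sub>c"
| NegR:  "\<turnstile>\<^sub>G\<^sub>c Semi (Fm \<alpha>) \<Gamma> \<Rightarrow> \<bottom>\<^sub>c \<Longrightarrow> \<turnstile>\<^sub>G\<^sub>c \<Gamma> \<Rightarrow> \<sim>\<^sub>c \<alpha>"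
| AndL1: "\<turnstile>\<^sub>G\<^sub>c \<Gamma>\<lbrakk>Fm \<alpha>\<rbrakk> \<Rightarrow> \<beta> \<Longrightarrow> \<turnstile>\<^sub>G\<^sub>c \<Gamma>\<lbrakk>Fm (\<alpha> \<and>\<^sub>c \<gamma>)\<rbrakk> \<Rightarrow> \<beta>"
| AndL2: "\<turnstile>\<^sub>G\<^sub>c \<Gamma>\<lbrakk>Fm \<alpha>\<rbrakk> \<Rightarrow> \<beta> \<Longrightarrow> \<turnstile>\<^sub>G\<^sub>c \<Gamma>\<lbrakk>Fm (\<gamma> \<and>\<^sub>c \<alpha>)\<rbrakk> \<Rightarrow> \<beta>"
| AndR:  "\<turnstile>\<^sub>G\<^sub>c \<Gamma> \<Rightarrow> \<alpha> \<Longrightarrow> \<turnstile>\<^sub>G\<^sub>c \<Gamma> \<Rightarrow> \<beta> \<Longrightarrow> \<turnstile>\<^sub>G\<^sub>c \<Gamma> \<Rightarrow> \<alpha> \<and>\<^sub>c \<beta>"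
| OrL:   "\<turnstile>\<^sub>G\<^sub>c \<Gamma>\<lbrakk>Fm \<alpha>\<rbrakk> \<Rightarrow> \<gamma> \<Longrightarrow> \<turnstile>\<^sub>G\<^sub>c \<Gamma>\<lbrakk>Fm \<beta>\<rbrakk> \<Rightarrow> \<gamma> \<Longrightarrow> \<turnstile>\<^sub>G\<^sub>c \<Gamma>\<lbrakk>Fm (\<alpha> \<or>\<^sub>c \<beta>)\<rbrakk> \<Rightarrow> \<gamma>"
| OrR1:  "\<turnstile>\<^sub>G\<^sub>c \<Gamma> \<Rightarrow> \<alpha> \<Longrightarrow> \<turnstile>\<^sub>G\<^sub>c \<Gamma> \<Rightarrow> \<alpha> \<or>\<^sub>c \<beta>"
| OrR2:  "\<turnstile>\<^sub>G\<^sub>c \<Gamma> \<Rightarrow> \<alpha> \<Longrightarrow> \<turnstile>\<^sub>G\<^sub>c \<Gamma> \<Rightarrow> \<beta> \<or>\<^sub>c \<alpha>"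
| Bot:   "\<turnstile>\<^sub>G\<^sub>c \<Delta> \<Rightarrow> \<bottom>\<^sub>c \<Longrightarrow> \<turnstile>\<^sub>G\<^sub>c \<Gamma>\<lbrakk>\<Delta>\<rbrakk> \<Rightarrow> \<alpha>"
| RBot:  "\<turnstile>\<^sub>G\<^sub>c Semi (Comma \<Delta>\<^sub>1 \<Delta>\<^sub>2) \<Delta>\<^sub>3 \<Rightarrow> \<bottom>\<^sub>c \<Longrightarrow> \<turnstile>\<^sub>G\<^sub>c Semi (Comma \<Delta>\<^sub>1 \<Delta>\<^sub>3) \<Delta>\<^sub>2 \<Rightarrow> \<bottom>\<^sub>c"
| Ex:    "\<turnstile>\<^sub>G\<^sub>c \<Gamma>\<lbrakk>Comma \<Delta>\<^sub>1 \<Delta>\<^sub>2\<rbrakk> \<Rightarrow> \<beta> \<Longrightarrow> \<turnstile>\<^sub>G\<^sub>c \<Gamma>\<lbrakk>Comma \<Delta>\<^sub>2 \<Delta>\<^sub>1\<rbrakk> \<Rightarrow> \<beta>"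
| ExS:   "\<turnstile>\<^sub>G\<^sub>c \<Gamma>\<lbrakk>Semi \<Delta>\<^sub>1 \<Delta>\<^sub>2\<rbrakk> \<Rightarrow> \<beta> \<Longrightarrow> \<turnstile>\<^sub>G\<^sub>c \<Gamma>\<lbrakk>Semi \<Delta>\<^sub>2 \<Delta>\<^sub>1\<rbrakk> \<Rightarrow> \<beta>"
| As1:   "\<turnstile>\<^sub>G\<^sub>c \<Gamma>\<lbrakk>Comma \<Delta>\<^sub>1 (Comma \<Delta>\<^sub>2 \<Delta>\<^sub>3)\<rbrakk> \<Rightarrow> \<beta> \<Longrightarrow> \<turnstile>\<^sub>G\<^sub>c \<Gamma>\<lbrakk>Comma (Comma \<Delta>\<^sub>1 \<Delta>\<^sub>2) \<Delta>\<^sub>3\<rbrakk> \<Rightarrow> \<beta>"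
| As2:   "\<turnstile>\<^sub>G\<^sub>c \<Gamma>\<lbrakk>Comma (Comma \<Delta>\<^sub>1 \<Delta>\<^sub>2) \<Delta>\<^sub>3\<rbrakk> \<Rightarrow> \<beta> \<Longrightarrow> \<turnstile>\<^sub>G\<^sub>c \<Gamma>\<lbrakk>Comma \<Delta>\<^sub>1 (Comma \<Delta>\<^sub>2 \<Delta>\<^sub>3)\<rbrakk> \<Rightarrow> \<beta>"
| koL:   "\<turnstile>\<^sub>G\<^sub>c \<Gamma>\<lbrakk>Fm (emb (ko \<alpha>))\<rbrakk> \<Rightarrow> \<beta> \<Longrightarrow> \<turnstile>\<^sub>G\<^sub>c \<Gamma>\<lbrakk>Fm (emb \<alpha>)\<rbrakk> \<Rightarrow> \<beta>"
| koR:   "\<turnstile>\<^sub>G\<^sub>c \<Gamma> \<Rightarrow> emb (ko \<alpha>) \<Longrightarrow> \<turnstile>\<^sub>G\<^sub>c \<Gamma> \<Rightarrow> emb \<alpha>"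

end

theory Submission imports Defs begin

text \<open>A semantic cut elimination in the style of Okada. Derivability of \<open>\<Gamma>; \<Delta> \<Rightarrow> \<bottom>\<close> in the cut-free
  calculus is a symmetric relation between structures, and hence yields a polarity. The sets of
  structures that are closed under double polar form a model of \<open>G\<close>: stability gives double negation
  elimination, and the rule \<open>R-\<bottom>\<close> makes residuals of stable sets stable. In this model every
  formula \<open>\<alpha>\<close> denotes a set that contains \<open>ko \<alpha>\<close> and all of whose elements derive \<open>ko \<alpha>\<close>. So
  a sequent derivable in \<open>G\<close> has a cut-free derivation of its \<open>ko\<close>-translation, from which
  \<open>koL\<close> and \<open>koR\<close> recover the sequent itself.\<close>

definition polar :: "'v struct set \<Rightarrow> 'v struct set" where
  "polar X = {\<Delta>. \<forall>\<Gamma>\<in>X. \<turnstile>\<^sub>G\<^sub>c Semi \<Gamma> \<Delta> \<Rightarrow> \<bottom>\<^sub>c}"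

lemma Semi_commute: "\<turnstile>\<^sub>G\<^sub>c Semi \<Gamma> \<Delta> \<Rightarrow> \<beta> \<Longrightarrow> \<turnstile>\<^sub>G\<^sub>c Semi \<Delta> \<Gamma> \<Rightarrow> \<beta>"
  using Gc.ExS[of Hole] by simp

lemma polarI: "(\<And>\<Gamma>. \<Gamma> \<in> X \<Longrightarrow> \<turnstile>\<^sub>G\<^sub>c Semi \<Gamma> \<Delta> \<Rightarrow> \<bottom>\<^sub>c) \<Longrightarrow> \<Delta> \<in> polar X"
  by (simp add: polar_def)

lemma polarD: "\<Delta> \<in> polar X \<Longrightarrow> \<Gamma> \<in> X \<Longrightarrow> \<turnstile>\<^sub>G\<^sub>c Semi \<Gamma> \<Delta> \<Rightarrow> \<bottom>\<^sub>c"
  by (simp add: polar_def)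

lemma polar_antimono: "X \<subseteq> Y \<Longrightarrow> polar Y \<subseteq> polar X"
  by (auto simp: polar_def)

lemma subset_polar_polar: "X \<subseteq> polar (polar X)"
  by (auto simp: polar_def intro: Semi_commute)

lemma polar_polar_polar [simp]: "polar (polar (polar X)) = polar X"
  by (meson polar_antimono subset_antisym subset_polar_polar)

lemma polar_polar_least: "X \<subseteq> Y \<Longrightarrow> polar (polar Y) = Y \<Longrightarrow> polar (polar X) \<subseteq> Y"
  by (metis polar_antimono)

lemma subset_polar_commute: "X \<subseteq> polar Y \<Longrightarrow> Y \<subseteq> polar X"
  using polar_antimono subset_polar_polar by blast

lemma stable_Int:
  assumes "polar (polar X) = X" "polar (polar Y) = Y"
  shows "polar (polar (X \<inter> Y)) = X \<inter> Y"
  using assms polar_polar_least[of "X \<inter> Y" X] polar_polar_least[of "X \<inter> Y" Y]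
    subset_polar_polar[of "X \<inter> Y"] by blast

definition residual :: "'v struct set \<Rightarrow> 'v struct set \<Rightarrow> 'v struct set" where
  "residual X Y = {\<Delta>. \<forall>\<Gamma>\<in>X. Comma \<Gamma> \<Delta> \<in> Y}"

text \<open>Membership in the stable set \<open>Y\<close> is a test against \<open>polar Y\<close>.
  \<open>RBot\<close> and \<open>Semi_commute\<close> let the test structure trade places with the
  right component of a comma, so a condition on \<open>Comma \<Gamma> \<Delta>\<close> becomes one
  on \<open>\<Delta>\<close> alone.\<close>

lemma residual_eq_polar:
  assumes "polar (polar Y) = Y"
  shows "residual X Y = polar (case_prod Comma ` (X \<times> polar Y))"
proof -
  have "\<turnstile>\<^sub>G\<^sub>c Semi \<Theta> (Comma \<Gamma> \<Delta>) \<Rightarrow> \<bottom>\<^sub>c \<longleftrightarrow> \<turnstile>\<^sub>G\<^sub>c Semi (Comma \<Gamma> \<Theta>) \<Delta> \<Rightarrow> \<bottom>\<^sub>c"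
    for \<Gamma> \<Delta> \<Theta> :: "'a struct"
    by (meson RBot Semi_commute)
  moreover have "\<Delta> \<in> residual X Y \<longleftrightarrow> (\<forall>\<Gamma>\<in>X. Comma \<Gamma> \<Delta> \<in> polar (polar Y))" for \<Delta>
    by (simp add: assms residual_def)
  ultimately show ?thesis
    by (auto simp: polar_def)
qed

lemma stable_residual:
  "polar (polar Y) = Y \<Longrightarrow> polar (polar (residual X Y)) = residual X Y"
  by (simp add: residual_eq_polar)

text \<open>A double polar is taken only where the set operation may leave the stable sets;
  intersections and residuals of stable sets, and all polars, are stable already.\<close>

fun sem :: "'v fm \<Rightarrow> 'v struct set" where
  "sem (Var p) = polar (polar {Fm (CVar p)})"
| "sem (\<alpha> \<cdot> \<beta>) = polar (polar (case_prod Comma ` (sem \<alpha> \<times> sem \<beta>)))"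
| "sem (\<alpha> \<setminus> \<beta>) = residual (sem \<alpha>) (sem \<beta>)"
| "sem (\<alpha> \<^bold>\<and> \<beta>) = sem \<alpha> \<inter> sem \<beta>"
| "sem (\<alpha> \<^bold>\<or> \<beta>) = polar (polar (sem \<alpha> \<union> sem \<beta>))"
| "sem (\<sim> \<alpha>) = polar (sem \<alpha>)"

lemma stable_sem [simp]: "polar (polar (sem \<alpha>)) = sem \<alpha>"
  by (induction \<alpha>) (simp_all add: stable_Int stable_residual)

text \<open>A stable set includes a double polar as soon as it includes the generators, so a product
  on the left can be handled through pairs.\<close>

lemma sem_Mult_subset_iff:
  "sem (\<alpha> \<cdot> \<beta>) \<subseteq> sem \<gamma> \<longleftrightarrow> (\<forall>A\<in>sem \<alpha>. \<forall>B\<in>sem \<beta>. Comma A B \<in> sem \<gamma>)"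
  (is "?L \<longleftrightarrow> ?R")
proof
  show "?L \<Longrightarrow> ?R"
    using subset_polar_polar[of "case_prod Comma ` (sem \<alpha> \<times> sem \<beta>)"] by auto
next
  assume ?R
  then have "case_prod Comma ` (sem \<alpha> \<times> sem \<beta>) \<subseteq> sem \<gamma>"
    by auto
  then show ?L
    using polar_polar_least[OF _ stable_sem] by simp
qed

text \<open>\<open>RBot\<close> moves only the right component of a comma; exchange brings the left
  one into reach. This is what the rule \<open>Neg\<close> of \<open>G\<close> demands of the
  model.\<close>

lemma Comma_Semi_rotate:
  assumes "\<turnstile>\<^sub>G\<^sub>c Semi (Comma A B) C \<Rightarrow> \<bottom>\<^sub>c"
  shows "\<turnstile>\<^sub>G\<^sub>c Semi (Comma C B) A \<Rightarrow> \<bottom>\<^sub>c"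
proof -
  have "\<turnstile>\<^sub>G\<^sub>c Semi (Comma B A) C \<Rightarrow> \<bottom>\<^sub>c"
    using assms Gc.Ex[of "SemiL Hole C"] by simp
  then have "\<turnstile>\<^sub>G\<^sub>c Semi (Comma B C) A \<Rightarrow> \<bottom>\<^sub>c"
    by (rule RBot)
  then show ?thesis
    using Gc.Ex[of "SemiL Hole A"] by simp
qed

text \<open>\<open>Cut\<close> becomes transitivity of inclusion and \<open>DN2\<close> becomes
  stability; the final \<open>auto\<close> settles these along with \<open>Id\<close> and the
  conjunction rules.\<close>

theorem sem_sound: "\<turnstile>\<^sub>G \<alpha> \<Rightarrow> \<beta> \<Longrightarrow> sem \<alpha> \<subseteq> sem \<beta>"
proof (induction rule: G.induct)
  case (Res \<alpha> \<beta> \<gamma>)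
  then show ?case
    unfolding sem_Mult_subset_iff by (auto simp: residual_def)
next
  case (ResInv \<beta> \<alpha> \<gamma>)
  then show ?case
    unfolding sem_Mult_subset_iff by (auto simp: residual_def)
next
  case (OrL \<alpha> \<beta> \<gamma>)
  then show ?case
    using polar_polar_least[of "sem \<alpha> \<union> sem \<gamma>", OF _ stable_sem] by simp
next
  case (OrR1 \<alpha> \<beta> \<gamma>)
  then show ?case
    using subset_polar_polar[of "sem \<beta> \<union> sem \<gamma>"] by auto
next
  case (OrR2 \<alpha> \<beta> \<gamma>)
  then show ?case
    using subset_polar_polar[of "sem \<gamma> \<union> sem \<beta>"] by auto
next
  case (Neg \<alpha> \<beta> \<gamma>)
  have "\<turnstile>\<^sub>G\<^sub>c Semi A (Comma C B) \<Rightarrow> \<bottom>\<^sub>c"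
    if "A \<in> sem \<alpha>" "B \<in> sem \<beta>" "C \<in> sem \<gamma>" for A B C
  proof -
    have "\<turnstile>\<^sub>G\<^sub>c Semi C (Comma A B) \<Rightarrow> \<bottom>\<^sub>c"
      using Neg.IH that unfolding sem_Mult_subset_iff by (simp add: polar_def)
    then show ?thesis
      by (rule Semi_commute[OF Comma_Semi_rotate[OF Semi_commute]])
  qed
  then show ?case
    unfolding sem_Mult_subset_iff by (simp add: polar_def)
next
  case (MN \<alpha> \<gamma>)
  then show ?case
    by (simp add: subset_polar_commute)
qed auto

definition sandwiched :: "'v struct set \<Rightarrow> 'v cfm \<Rightarrow> bool" where
  "sandwiched X \<delta> \<longleftrightarrow> Fm \<delta> \<in> X \<and> (\<forall>\<Gamma>\<in>X. \<turnstile>\<^sub>G\<^sub>c \<Gamma> \<Rightarrow> \<delta>)"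

text \<open>The formula is required only in the double polar of \<open>X\<close>, because
  \<open>X\<close> itself may lack it: the generators of a product are commas, never single
  formulas.\<close>

lemma sandwiched_Neg:
  assumes "Fm \<delta> \<in> polar (polar X)" and "\<And>\<Gamma>. \<Gamma> \<in> X \<Longrightarrow> \<turnstile>\<^sub>G\<^sub>c \<Gamma> \<Rightarrow> \<delta>"
  shows "sandwiched (polar X) (\<sim>\<^sub>c \<delta>)"
  unfolding sandwiched_def
proof (intro conjI ballI)
  show "Fm (\<sim>\<^sub>c \<delta>) \<in> polar X"
    by (intro polarI NegL assms(2))
next
  fix \<Gamma> assume "\<Gamma> \<in> polar X"
  then show "\<turnstile>\<^sub>G\<^sub>c \<Gamma> \<Rightarrow> \<sim>\<^sub>c \<delta>"
    by (intro NegR Semi_commute[OF polarD[OF assms(1)]])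
qed

text \<open>Without cut, elements of the double polar of \<open>X\<close> are not known to derive
  \<open>\<delta>\<close> itself. Passing through negation twice repairs this, which is why
  \<open>ko\<close> inserts double negations.\<close>

lemma sandwiched_Neg_Neg:
  assumes "Fm \<delta> \<in> polar (polar X)" and "\<And>\<Gamma>. \<Gamma> \<in> X \<Longrightarrow> \<turnstile>\<^sub>G\<^sub>c \<Gamma> \<Rightarrow> \<delta>"
  shows "sandwiched (polar (polar X)) (\<sim>\<^sub>c \<sim>\<^sub>c \<delta>)"
  using sandwiched_Neg[OF assms] sandwiched_Neg[of "\<sim>\<^sub>c \<delta>" "polar X"]
  by (simp add: sandwiched_def)

text \<open>For each binary connective, its left rule puts the formula into the double polar of
  \<open>?X\<close>, its right rule derives the formula from every element of \<open>?X\<close>, and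
  \<open>sandwiched_Neg_Neg\<close> concludes.\<close>

theorem sandwiched_sem: "sandwiched (sem \<alpha>) (emb (ko \<alpha>))"
proof (induction \<alpha>)
  case (Var p)
  show ?case
    using sandwiched_Neg_Neg[of "CVar p" "{Fm (CVar p)}"] subset_polar_polar[of "{Fm (CVar p)}"]
    by (simp add: Gc.Id)
next
  case (Mult \<alpha> \<beta>)
  let ?X = "case_prod Comma ` (sem \<alpha> \<times> sem \<beta>)"
  have "Fm (emb (ko \<alpha>) \<cdot>\<^sub>c emb (ko \<beta>)) \<in> polar (polar ?X)"
  proof (rule polarI)
    fix \<Delta> assume "\<Delta> \<in> polar ?X"
    \<comment> \<open>By the induction hypotheses this comma is among the generators in
      \<open>?X\<close>, so \<open>\<Delta>\<close> is orthogonal to it.\<close>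
    then have "\<turnstile>\<^sub>G\<^sub>c Semi (Comma (Fm (emb (ko \<alpha>))) (Fm (emb (ko \<beta>)))) \<Delta> \<Rightarrow> \<bottom>\<^sub>c"
      using Mult by (auto simp: sandwiched_def elim!: polarD)
    then show "\<turnstile>\<^sub>G\<^sub>c Semi \<Delta> (Fm (emb (ko \<alpha>) \<cdot>\<^sub>c emb (ko \<beta>))) \<Rightarrow> \<bottom>\<^sub>c"
      by (intro Semi_commute[OF MultL[of "SemiL Hole \<Delta>", simplified]])
  qed
  moreover have "\<turnstile>\<^sub>G\<^sub>c \<Gamma> \<Rightarrow> emb (ko \<alpha>) \<cdot>\<^sub>c emb (ko \<beta>)" if "\<Gamma> \<in> ?X" for \<Gamma>
    using Mult that by (auto simp: sandwiched_def intro: MultR)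
  ultimately show ?case
    using sandwiched_Neg_Neg[of _ ?X] by simp
next
  case (LDiv \<alpha> \<beta>)
  let ?X = "residual (sem \<alpha>) (sem \<beta>)"
  have stable: "polar (polar ?X) = ?X"
    by (simp add: stable_residual)
  \<comment> \<open>The set \<open>sem \<beta>\<close> equals its double polar, so membership can be
    tested against \<open>polar (sem \<beta>)\<close>; \<open>LDivL\<close> then acts to the left of
    the semicolon.\<close>
  have "Comma \<Gamma> (Fm (emb (ko \<alpha>) \<setminus>\<^sub>c emb (ko \<beta>))) \<in> polar (polar (sem \<beta>))"
    if "\<Gamma> \<in> sem \<alpha>" for \<Gamma>
  proof (rule polarI)
    fix \<Theta> assume "\<Theta> \<in> polar (sem \<beta>)"
    then have "\<turnstile>\<^sub>G\<^sub>c Semi (Fm (emb (ko \<beta>))) \<Theta> \<Rightarrow> \<bottom>\<^sub>c"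
      using LDiv by (simp add: sandwiched_def polarD)
    moreover have "\<turnstile>\<^sub>G\<^sub>c \<Gamma> \<Rightarrow> emb (ko \<alpha>)"
      using LDiv that by (simp add: sandwiched_def)
    ultimately show "\<turnstile>\<^sub>G\<^sub>c Semi \<Theta> (Comma \<Gamma> (Fm (emb (ko \<alpha>) \<setminus>\<^sub>c emb (ko \<beta>)))) \<Rightarrow> \<bottom>\<^sub>c"
      by (intro Semi_commute[OF LDivL[of \<Gamma> _ "SemiL Hole \<Theta>", simplified]])
  qed
  then have "Fm (emb (ko \<alpha>) \<setminus>\<^sub>c emb (ko \<beta>)) \<in> ?X"
    by (simp add: residual_def)
  moreover have "\<turnstile>\<^sub>G\<^sub>c \<Gamma> \<Rightarrow> emb (ko \<alpha>) \<setminus>\<^sub>c emb (ko \<beta>)" if "\<Gamma> \<in> ?X" for \<Gamma>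
    using LDiv that by (auto simp: sandwiched_def residual_def intro: LDivR)
  ultimately show ?case
    using sandwiched_Neg_Neg[of _ ?X] by (simp add: stable)
next
  case (And \<alpha> \<beta>)
  let ?X = "sem \<alpha> \<inter> sem \<beta>"
  let ?\<delta> = "emb (ko \<alpha>) \<and>\<^sub>c emb (ko \<beta>)"
  have stable: "polar (polar ?X) = ?X"
    by (simp add: stable_Int)
  have "Fm ?\<delta> \<in> polar (polar (sem \<alpha>))"
  proof (rule polarI)
    fix \<Delta> assume "\<Delta> \<in> polar (sem \<alpha>)"
    then have "\<turnstile>\<^sub>G\<^sub>c Semi (Fm (emb (ko \<alpha>))) \<Delta> \<Rightarrow> \<bottom>\<^sub>c"
      using And by (simp add: sandwiched_def polarD)
    then show "\<turnstile>\<^sub>G\<^sub>c Semi \<Delta> (Fm ?\<delta>) \<Rightarrow> \<bottom>\<^sub>c"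
      by (intro Semi_commute[OF Gc.AndL1[of "SemiL Hole \<Delta>", simplified]])
  qed
  moreover have "Fm ?\<delta> \<in> polar (polar (sem \<beta>))"
  proof (rule polarI)
    fix \<Delta> assume "\<Delta> \<in> polar (sem \<beta>)"
    then have "\<turnstile>\<^sub>G\<^sub>c Semi (Fm (emb (ko \<beta>))) \<Delta> \<Rightarrow> \<bottom>\<^sub>c"
      using And by (simp add: sandwiched_def polarD)
    then show "\<turnstile>\<^sub>G\<^sub>c Semi \<Delta> (Fm ?\<delta>) \<Rightarrow> \<bottom>\<^sub>c"
      by (intro Semi_commute[OF Gc.AndL2[of "SemiL Hole \<Delta>", simplified]])
  qed
  moreover have "\<turnstile>\<^sub>G\<^sub>c \<Gamma> \<Rightarrow> ?\<delta>" if "\<Gamma> \<in> ?X" for \<Gamma>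
    using And that by (simp add: sandwiched_def Gc.AndR)
  ultimately show ?case
    using sandwiched_Neg_Neg[of ?\<delta> ?X] by (simp add: stable)
next
  case (Or \<alpha> \<beta>)
  let ?X = "sem \<alpha> \<union> sem \<beta>"
  let ?\<delta> = "emb (ko \<alpha>) \<or>\<^sub>c emb (ko \<beta>)"
  have "Fm ?\<delta> \<in> polar (polar ?X)"
  proof (rule polarI)
    fix \<Delta> assume "\<Delta> \<in> polar ?X"
    then have "\<turnstile>\<^sub>G\<^sub>c Semi (Fm (emb (ko \<alpha>))) \<Delta> \<Rightarrow> \<bottom>\<^sub>c" "\<turnstile>\<^sub>G\<^sub>c Semi (Fm (emb (ko \<beta>))) \<Delta> \<Rightarrow> \<bottom>\<^sub>c"
      using Or by (simp_all add: sandwiched_def polarD)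
    then show "\<turnstile>\<^sub>G\<^sub>c Semi \<Delta> (Fm ?\<delta>) \<Rightarrow> \<bottom>\<^sub>c"
      by (intro Semi_commute[OF Gc.OrL[of "SemiL Hole \<Delta>", simplified]])
  qed
  moreover have "\<turnstile>\<^sub>G\<^sub>c \<Gamma> \<Rightarrow> ?\<delta>" if "\<Gamma> \<in> ?X" for \<Gamma>
    using Or that by (auto simp: sandwiched_def intro: Gc.OrR1 Gc.OrR2)
  ultimately show ?case
    using sandwiched_Neg_Neg[of ?\<delta> ?X] by simp
next
  case (Neg \<alpha>)
  \<comment> \<open>A single polar matches a single negation, so \<open>ko\<close> adds nothing
    here; stability turns membership in \<open>sem \<alpha>\<close> into the double polar
    premise.\<close>
  then show ?case
    using sandwiched_Neg[of "emb (ko \<alpha>)" "sem \<alpha>"] by (simp add: sandwiched_def)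
qed

theorem theorem9:
  fixes \<alpha> \<beta> :: "'v fm"
  assumes "\<turnstile>\<^sub>G \<alpha> \<Rightarrow> \<beta>"
  shows "\<turnstile>\<^sub>G\<^sub>c Fm (emb \<alpha>) \<Rightarrow> emb \<beta>"
proof -
  \<comment> \<open>The translation of \<open>\<alpha>\<close> lies in \<open>sem \<alpha>\<close>,
    hence in \<open>sem \<beta>\<close>, all of whose elements derive the translation of
    \<open>\<beta>\<close>.\<close>
  have "\<turnstile>\<^sub>G\<^sub>c Fm (emb (ko \<alpha>)) \<Rightarrow> emb (ko \<beta>)"
    using sem_sound[OF assms] sandwiched_sem[of \<alpha>] sandwiched_sem[of \<beta>]
    by (auto simp: sandwiched_def)
  then show ?thesis
    by (rule koR[OF koL[of Hole, simplified]])
qed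

end
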